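(* Let $G=(V,A)$ be a directed graph with $n=|V|$ and arc costs $c:A\to\mathbb{Z}_+$, let $s\neq t\in V$ be source and sink, $\lambda\in\mathbb{Z}^{n-1}$, $\varepsilon\ge 0$, and $B=(1+\varepsilon)\cdot f^*_\lambda(s,t)$. Then Algorithm 2 (described in the context) correctly computes the set of all universal near shortest simple paths between $s$ and $t$, i.e. the set $\{P\in\mathcal{P}_{st} : f_\lambda(P)\le B\}$.
   Context: $\mathbb{Z}_+$ denotes the nonnegative integers. All paths are simple (no repeated vertices); $\mathcal{P}_{uv}$ is the set of all simple directed $u$-$v$-paths in $G$; $l(P)\le n-1$ is the number of arcs of $P$. For a path $P$, let $c_{(i)}(P)$ be the $i$-th largest arc cost on $P$ for $1\le i\le l(P)$, and $c_{(i)}(P)=0$ for $l(P)<i\le n-1$. For $\lambda\in\mathbb{Z}^{n-1}$ put $f_\lambda(P)=\sum_{i=1}^{n-1}\lambda_i c_{(i)}(P)$. The Universal Shortest Path Problem USPP$(G,\lambda)$ is $\min_{P\in\mathcal{P}_{st}}f_\lambda(P)$; $f^*_\lambda(u,v)$ is the minimum of $f_\lambda$ over $\mathcal{P}_{uv}$. The value $f^*_\lambda(s,t)$ is given as input (so $\mathcal{P}_{st}\ne\emptyset$). A universal near shortest simple path is a $P\in\mathcal{P}_{st}$ with $f_\lambda(P)\le B=(1+\varepsilon)f^*_\lambda(s,t)$. $\delta^+_G(u)$ is the set of outgoing arcs of $u$ in $G$; $\mathrm{pred}_P(u)$ is the predecessor of $u$ on path $P$, with $\mathrm{pred}_P(s):=\emptyset$;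 $G\setminus F$ is $G$ with the arcs in $F$ removed. In graph updates, arc sets are added to or removed from the arc set of $G'$, operations being performed from left to right. Algorithm 2. Initialization: compute an optimal path $P$ of USPP$(G,\lambda)$, with vertices $s=v_0,v_1,\dots,v_k=t$. Put $F=\bigcup_{i=0}^{k-2}\big(\delta^+_G(v_i)\setminus\{(v_i,v_{i+1})\}\big)\cup\{(v_{k-1},v_k)\}$ and $G'=G\setminus F$. Set $C[v]=\emptyset$ for all $v\in V$, then $C[v_{k-1}]\leftarrow C[v_{k-1}]\cup\{(v_{k-1},v_k)\}$, and $v\leftarrow v_{k-1}$. The path $P$ counts as output if $f_\lambda(P)\le B$. Then call $\mathrm{UNSSP}(G',C,v,P)$. Procedure $\mathrm{UNSSP}(G',C,v,P)$: 1. If $v=\emptyset$, stop. 2. Let $P'$ be an optimal path of USPP$(G',\lambda)$ from $s$ to $t$, with vertices $s=v'_0,\dots,v'_l=t$; if there is no $s$-$t$-path in $G'$, $P'$ is the empty path $(.)$. 3. If $P'=(.)$ or $f_\lambda(P')>B$: set $C[v]\leftarrow\emptyset$; $C[\mathrm{pred}_P(v)]\leftarrow C[\mathrm{pred}_P(v)]\cup\{(\mathrm{pred}_P(v),v)\}$; $G'\leftarrow G'\cup\delta^+_G(v)\cup\delta^+_G(\mathrm{pred}_P(v))\setminus C[\mathrm{pred}_P(v)]$; $v\leftarrow\mathrm{pred}_P(v)$ (operations involving $\mathrm{pred}_P(v)$ other than the last are void when $v=s$); call $\mathrm{UNSSP}(G',C,v,P)$. 4. Otherwise: print $P'$; set $C[v'_{l-1}]\leftarrow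 C[v'_{l-1}]\cup\{(v'_{l-1},v'_l)\}$; $F\leftarrow\bigcup_{i=0}^{l-2}\big(\delta^+_G(v'_i)\setminus\{(v'_i,v'_{i+1})\}\big)\cup\{(v'_{l-1},v'_l)\}$; $G'\leftarrow G'\setminus F$; $v\leftarrow v'_{l-1}$; call $\mathrm{UNSSP}(G',C,v,P')$. The computed set is the set of all output/printed paths. *)

theory Defs
  imports Complex_Main "Graph_Theory.Pair_Digraph"
begin

section \<open>The universal shortest path problem\<close>

text \<open>
  A path is represented by its list of arcs. Self-loops are permitted in the graph; they never lie
  on a simple path.
\<close>

definition simple_paths :: "'a pair_pre_digraph \<Rightarrow> 'a \<Rightarrow> 'a \<Rightarrow> ('a \<times> 'a) awalk set" where
  "simple_paths G u v = {P. pre_digraph.apath (with_proj G) u P v}"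

definition ith_largest :: "('a \<times> 'a \<Rightarrow> nat) \<Rightarrow> ('a \<times> 'a) awalk \<Rightarrow> nat \<Rightarrow> nat" where
  "ith_largest c P i =
     (if 1 \<le> i \<and> i \<le> length P then rev (sort (map c P)) ! (i - 1) else 0)"

text \<open>
  The weight vector is a function of which only the entries \<open>1, \<dots>, n - 1\<close> are used. The number
  \<open>n\<close> of vertices is taken from the graph argument; the algorithm below only changes arc sets, so
  that all graphs occurring in one run have the same objective function.
\<close>

definition univ_cost ::
    "'a pair_pre_digraph \<Rightarrow> ('a \<times> 'a \<Rightarrow> nat) \<Rightarrow> (nat \<Rightarrow> int) \<Rightarrow> ('a \<times> 'a) awalk \<Rightarrow> int" where
  "univ_cost G c lam P = (\<Sum>i = 1..card (pverts G) - 1. lam i * int (ith_largest c P i))"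

definition uspp_optimal ::
    "'a pair_pre_digraph \<Rightarrow> ('a \<times> 'a \<Rightarrow> nat) \<Rightarrow> (nat \<Rightarrow> int) \<Rightarrow> 'a \<Rightarrow> 'a \<Rightarrow> ('a \<times> 'a) awalk \<Rightarrow> bool" where
  "uspp_optimal G c lam u v P \<longleftrightarrow>
     is_arg_min (univ_cost G c lam) (\<lambda>Q. Q \<in> simple_paths G u v) P"

definition uspp_value ::
    "'a pair_pre_digraph \<Rightarrow> ('a \<times> 'a \<Rightarrow> nat) \<Rightarrow> (nat \<Rightarrow> int) \<Rightarrow> 'a \<Rightarrow> 'a \<Rightarrow> int" where
  "uspp_value G c lam u v = Min (univ_cost G c lam ` simple_paths G u v)"

definition near_shortest_paths ::
    "'a pair_pre_digraph \<Rightarrow> ('a \<times> 'a \<Rightarrow> nat) \<Rightarrow> (nat \<Rightarrow> int) \<Rightarrow> 'a \<Rightarrow> 'a \<Rightarrow> real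
       \<Rightarrow> ('a \<times> 'a) awalk set" where
  "near_shortest_paths G c lam s t B =
     {P \<in> simple_paths G s t. real_of_int (univ_cost G c lam P) \<le> B}"


section \<open>The enumeration algorithm\<close>

definition pred_on :: "('a \<times> 'a) awalk \<Rightarrow> 'a \<Rightarrow> 'a option" where
  "pred_on P u = map_option fst (find (\<lambda>a. snd a = u) P)"

definition remove_arcs :: "'a pair_pre_digraph \<Rightarrow> ('a \<times> 'a) set \<Rightarrow> 'a pair_pre_digraph" where
  "remove_arcs H F = H\<lparr>parcs := parcs H - F\<rparr>"

definition insert_arcs :: "'a pair_pre_digraph \<Rightarrow> ('a \<times> 'a) set \<Rightarrow> 'a pair_pre_digraph" where
  "insert_arcs H F = H\<lparr>parcs := parcs H \<union> F\<rparr>"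

text \<open>
  The set \<open>F\<close> belonging to a nonempty path with vertices \<open>v\<^sub>0, \<dots>, v\<^sub>k\<close>: the arcs in
  \<open>butlast P\<close> are the \<open>(v\<^sub>i, v\<^sub>i\<^sub>+\<^sub>1)\<close> with \<open>i \<le> k - 2\<close>, and \<open>last P\<close> is the arc \<open>(v\<^sub>k\<^sub>-\<^sub>1, v\<^sub>k)\<close>.
\<close>

definition fixing_arcs :: "'a pair_pre_digraph \<Rightarrow> ('a \<times> 'a) awalk \<Rightarrow> ('a \<times> 'a) set" where
  "fixing_arcs G P =
     (\<Union>a \<in> set (butlast P). out_arcs (with_proj G) (fst a) - {a}) \<union> {last P}"

text \<open>
  Every call of the recursive procedure is a tail call, so a run is a sequence of states: the
  arguments \<open>G'\<close>, \<open>C\<close>, \<open>v\<close>, \<open>P\<close> of the next call together with the list of paths output so far.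
  The value \<open>None\<close> of \<open>cursor\<close> encodes \<open>v = \<emptyset>\<close>. Optimal paths need not be unique and the
  algorithm may use any of them; hence the initialization and the recursive calls are relations.
\<close>

record 'a unssp_state =
  residual :: "'a pair_pre_digraph"
  forbidden :: "'a \<Rightarrow> ('a \<times> 'a) set"
  cursor :: "'a option"
  current :: "('a \<times> 'a) awalk"
  printed :: "('a \<times> 'a) awalk list"

inductive unssp_init ::
    "'a pair_pre_digraph \<Rightarrow> ('a \<times> 'a \<Rightarrow> nat) \<Rightarrow> (nat \<Rightarrow> int) \<Rightarrow> 'a \<Rightarrow> 'a \<Rightarrow> real
       \<Rightarrow> 'a unssp_state \<Rightarrow> bool"
  for G c lam s t B where
  "uspp_optimal G c lam s t P \<Longrightarrow>
   unssp_init G c lam s t B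
     \<lparr>residual = remove_arcs G (fixing_arcs G P),
      forbidden = (\<lambda>_. {})(fst (last P) := {last P}),
      cursor = Some (fst (last P)),
      current = P,
      printed = (if real_of_int (univ_cost G c lam P) \<le> B then [P] else [])\<rparr>"

definition search_fails ::
    "'a pair_pre_digraph \<Rightarrow> ('a \<times> 'a \<Rightarrow> nat) \<Rightarrow> (nat \<Rightarrow> int) \<Rightarrow> 'a \<Rightarrow> 'a \<Rightarrow> real \<Rightarrow> bool" where
  "search_fails H c lam s t B \<longleftrightarrow>
     simple_paths H s t = {} \<or>
     (\<exists>P'. uspp_optimal H c lam s t P' \<and> real_of_int (univ_cost H c lam P') > B)"

text \<open>
  The two backtracking rules are the cases \<open>v \<noteq> s\<close> and \<open>v = s\<close>. There is no rule for
  \<open>cursor = None\<close>, where the procedure stops.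
\<close>

inductive unssp_step ::
    "'a pair_pre_digraph \<Rightarrow> ('a \<times> 'a \<Rightarrow> nat) \<Rightarrow> (nat \<Rightarrow> int) \<Rightarrow> 'a \<Rightarrow> 'a \<Rightarrow> real
       \<Rightarrow> 'a unssp_state \<Rightarrow> 'a unssp_state \<Rightarrow> bool"
  for G c lam s t B where
  backtrack:
    "\<lbrakk>search_fails H c lam s t B;
      pred_on P v = Some u;
      C1 = C(v := {});
      C2 = C1(u := C1 u \<union> {(u, v)});
      H' = remove_arcs
             (insert_arcs (insert_arcs H (out_arcs (with_proj G) v)) (out_arcs (with_proj G) u))
             (C2 u)\<rbrakk> \<Longrightarrow>
     unssp_step G c lam s t B
       \<lparr>residual = H, forbidden = C, cursor = Some v, current = P, printed = out\<rparr>
       \<lparr>residual = H', forbidden = C2, cursor = Some u, current = P, printed = out\<rparr>"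
| backtrack_source:
    "\<lbrakk>search_fails H c lam s t B;
      pred_on P v = None\<rbrakk> \<Longrightarrow>
     unssp_step G c lam s t B
       \<lparr>residual = H, forbidden = C, cursor = Some v, current = P, printed = out\<rparr>
       \<lparr>residual = insert_arcs H (out_arcs (with_proj G) v), forbidden = C(v := {}),
        cursor = None, current = P, printed = out\<rparr>"
| advance:
    "\<lbrakk>uspp_optimal H c lam s t P';
      real_of_int (univ_cost H c lam P') \<le> B;
      w = fst (last P')\<rbrakk> \<Longrightarrow>
     unssp_step G c lam s t B
       \<lparr>residual = H, forbidden = C, cursor = Some v, current = P, printed = out\<rparr>
       \<lparr>residual = remove_arcs H (fixing_arcs G P'), forbidden = C(w := C w \<union> {last P'}),
        cursor = Some w, current = P', printed = out @ [P']\<rparr>"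

end

(* The search tree is the tree of prefixes of s-t-paths. In every state the residual graph is such
   that its s-t-paths are exactly the s-t-paths of G which follow the current path up to the cursor
   and leave the cursor by an arc that is not forbidden. Advancing to P' therefore removes
   precisely P' from the set of unexplored paths; backtracking removes exactly the s-t-paths of
   the residual graph, all of which cost more than B. For termination, the number of unexplored
   paths, and then the depth of the cursor, decreases lexicographically. *)

theory Submission
  imports Defs
begin

section \<open>Simple paths as arc lists\<close>

lemma take_eq_mono:
  assumes "take j xs = take j ys" and "i \<le> j"
  shows "take i xs = take i ys"
proof -
  have "take i (take j xs) = take i (take j ys)" using assms(1) by simp
  then show ?thesis using assms(2) by (simp add: min_def)
qed

lemma take_eq_nth:
  assumes "take j xs = take j ys" and "i < j"
  shows "xs ! i = ys ! i"
proof -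
  have "take j xs ! i = take j ys ! i" using assms(1) by simp
  then show ?thesis using assms(2) by simp
qed

text \<open>A walk depends on the graph only through its vertices and arcs, so shrinking the arc set
  merely filters the paths. This is the link between residual graphs and \<open>G\<close>.\<close>

lemma simple_paths_subgraph:
  assumes "pverts H = pverts G" and "parcs H \<subseteq> parcs G"
  shows "Q \<in> simple_paths H u v \<longleftrightarrow> Q \<in> simple_paths G u v \<and> set Q \<subseteq> parcs H"
  using assms
  by (auto simp: simple_paths_def pre_digraph.apath_def pre_digraph.awalk_def
      cas_with_proj_eq awalk_verts_with_proj_eq)

text \<open>The objective sees the graph only through its number of vertices; costs in residual
  graphs are therefore costs in \<open>G\<close>.\<close>

lemma univ_cost_cong: "pverts H = pverts G \<Longrightarrow> univ_cost H = univ_cost G"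
  by (simp add: univ_cost_def fun_eq_iff)

lemma finite_simple_paths:
  assumes "pair_fin_digraph G"
  shows "finite (simple_paths G u v)"
proof -
  interpret pair_fin_digraph G by fact
  show ?thesis using apaths_finite[of u v] by (simp add: simple_paths_def)
qed

lemma pcas_nth_Suc:
  assumes "pcas u P v" "Suc i < length P"
  shows "snd (P ! i) = fst (P ! Suc i)"
  using assms
proof (induction u P v arbitrary: i rule: pcas.induct)
  case (2 u e es v)
  then show ?case by (cases i; cases es) auto
qed simp

lemma pcas_last: "pcas u P v \<Longrightarrow> P \<noteq> [] \<Longrightarrow> snd (last P) = v"
  by (induction u P v rule: pcas.induct) (auto split: if_splits)

section \<open>Positions of vertices on one simple path\<close>

context
  fixes G :: "'a pair_pre_digraph" and s t :: 'a and P :: "('a \<times> 'a) awalk"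
  assumes P: "P \<in> simple_paths G s t" and st: "s \<noteq> t"
begin

lemma simple_path_pcas: "pcas s P t"
  using P by (auto simp: simple_paths_def pre_digraph.apath_def pre_digraph.awalk_def
      cas_with_proj_eq)

lemma simple_path_arcs: "set P \<subseteq> parcs G"
  using P by (auto simp: simple_paths_def pre_digraph.apath_def pre_digraph.awalk_def)

lemma simple_path_nonempty: "P \<noteq> []"
  using simple_path_pcas st by auto

lemma simple_path_start: "fst (P ! 0) = s"
  using simple_path_pcas simple_path_nonempty by (cases P) auto

lemma simple_path_consecutive: "Suc i < length P \<Longrightarrow> snd (P ! i) = fst (P ! Suc i)"
  using simple_path_pcas by (rule pcas_nth_Suc)

lemma simple_path_end: "snd (last P) = t"
  using simple_path_pcas simple_path_nonempty by (rule pcas_last)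

text \<open>A nonempty path visits the tails of its arcs and then the head of the last one, so
  simplicity becomes distinctness of a single list, and tails identify positions.\<close>

lemma simple_path_distinct_verts: "distinct (map fst P @ [t])"
proof -
  have "distinct (pre_digraph.awalk_verts (with_proj G) s P)"
    using P by (simp add: simple_paths_def pre_digraph.apath_def)
  then show ?thesis
    using simple_path_nonempty simple_path_end by (simp add: pre_digraph.awalk_verts_conv)
qed

lemma simple_path_distinct: "distinct (map fst P)"
  and simple_path_target_notin: "t \<notin> fst ` set P"
  using simple_path_distinct_verts by auto

lemma simple_path_fst_eq_iff:
  "\<lbrakk>i < length P; j < length P\<rbrakk> \<Longrightarrow> fst (P ! i) = fst (P ! j) \<longleftrightarrow> i = j"
  using nth_eq_iff_index_eq[OF simple_path_distinct, of i j] by simp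

lemma simple_path_snd_eq_iff:
  assumes "i < length P" "j < length P"
  shows "snd (P ! i) = fst (P ! j) \<longleftrightarrow> Suc i = j"
proof (cases "Suc i < length P")
  case True
  then show ?thesis using assms simple_path_consecutive simple_path_fst_eq_iff by metis
next
  case False
  \<comment> \<open>The last arc enters \<open>t\<close>, which is no tail, so both sides are
    false.\<close>
  then have "P ! i = last P"
    using assms simple_path_nonempty
    by (metis Suc_lessI diff_Suc_1 last_conv_nth)
  then have "snd (P ! i) = t" using simple_path_end by simp
  then have "snd (P ! i) \<noteq> fst (P ! j)"
    using simple_path_target_notin assms by (auto dest: nth_mem)
  then show ?thesis using False assms by auto
qed

text \<open>Turns the vertex tests in \<open>consistent\<close> into comparisons of positions, as
  tails do not repeat.\<close>

lemma simple_path_fst_in_take_iff: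
  assumes "i < length P" "k \<le> length P"
  shows "fst (P ! i) \<in> fst ` set (take k P) \<longleftrightarrow> i < k"
proof -
  have "fst ` set (take k P) = (\<lambda>j. fst (P ! j)) ` {..<k}"
    using assms(2) by (simp add: nth_image[symmetric] image_image lessThan_atLeast0)
  then show ?thesis using assms simple_path_fst_eq_iff by auto
qed

text \<open>No arc re-enters the source, and every other tail is the head of the arc just before it
  only. Backtracking thereby becomes subtraction on positions.\<close>

lemma pred_on_nth:
  assumes "k < length P"
  shows "pred_on P (fst (P ! k)) = (if k = 0 then None else Some (fst (P ! (k - 1))))"
proof (cases k)
  case 0
  have "snd (P ! i) \<noteq> fst (P ! k)" if "i < length P" for i
    using simple_path_snd_eq_iff[OF that assms] 0 by simp
  then have "find (\<lambda>a. snd a = fst (P ! k)) P = None"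
    unfolding find_None_iff by (metis in_set_conv_nth)
  then show ?thesis using 0 by (simp add: pred_on_def)
next
  case (Suc j)
  have "find (\<lambda>a. snd a = fst (P ! k)) P = Some (P ! j)"
    unfolding find_Some_iff
    using Suc assms simple_path_snd_eq_iff[of _ k] by (intro exI[of _ j]) simp
  then show ?thesis using Suc by (simp add: pred_on_def)
qed

end

section \<open>Branching of two simple paths\<close>

lemma simple_paths_agree:
  assumes P: "P \<in> simple_paths G s t" and Q: "Q \<in> simple_paths G s t" and st: "s \<noteq> t"
    and eq: "take i Q = take i P" and i: "i < length P"
  shows "i < length Q" and "fst (Q ! i) = fst (P ! i)"
proof -
  note p = P st and q = Q st
  have "i < length Q \<and> fst (Q ! i) = fst (P ! i)"
  proof (cases i)
    case 0
    then show ?thesis using simple_path_start[OF p] simple_path_start[OF q] simple_path_nonempty[OF q]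
      by simp
  next
    case (Suc j)
    have len: "i \<le> length Q"
    proof -
      have "length (take i Q) = length (take i P)" using eq by simp
      then show ?thesis using i by simp
    qed
    have "Q ! j = P ! j" using eq Suc by (simp add: take_eq_nth[OF eq])
    then have sndj: "snd (Q ! j) = fst (P ! i)"
      using simple_path_consecutive[OF p, of j] Suc i by simp
    \<comment> \<open>If \<open>Q\<close> ended here, the common vertex would be \<open>t\<close>,
      yet \<open>P\<close> leaves that vertex by an arc.\<close>
    have "i \<noteq> length Q"
    proof
      assume "i = length Q"
      then have "j = length Q - 1" using Suc by simp
      then have "Q ! j = last Q" using simple_path_nonempty[OF q] by (simp add: last_conv_nth)
      then have "fst (P ! i) = t" using sndj simple_path_end[OF q] by simp
      then show False using simple_path_target_notin[OF p] i by (metis image_eqI nth_mem)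
    qed
    then have "i < length Q" using len by simp
    then show ?thesis using simple_path_consecutive[OF q, of j] Suc sndj by simp
  qed
  then show "i < length Q" "fst (Q ! i) = fst (P ! i)" by auto
qed

lemma first_divergence:
  assumes "P \<in> simple_paths G s t" "Q \<in> simple_paths G s t" "s \<noteq> t" "Q \<noteq> P"
  obtains i where "i < length P" "i < length Q" "take i Q = take i P" "Q ! i \<noteq> P ! i"
    "fst (Q ! i) = fst (P ! i)"
proof -
  \<comment> \<open>With \<open>Suc i\<close> inside, the least index is the position of the first
    differing arc and not the length of the prefix containing it.\<close>
  define i where "i = (LEAST i. take (Suc i) Q \<noteq> take (Suc i) P)"
  have "take (Suc (length P + length Q)) Q \<noteq> take (Suc (length P + length Q)) P"
    using assms by simp
  then have ne: "take (Suc i) Q \<noteq> take (Suc i) P" unfolding i_def by (rule LeastI)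
  have eq: "take i Q = take i P"
    using not_less_Least[of "i - 1" "\<lambda>i. take (Suc i) Q \<noteq> take (Suc i) P"]
    by (cases i) (auto simp: i_def[symmetric])
  have "i < length P \<or> i < length Q"
  proof (rule ccontr)
    assume "\<not> ?thesis"
    then show False using ne eq by simp
  qed
  then have len: "i < length P" "i < length Q" "fst (Q ! i) = fst (P ! i)"
    using simple_paths_agree[OF assms(1,2,3) eq] simple_paths_agree[OF assms(2,1,3) eq[symmetric]]
    by auto
  moreover have "Q ! i \<noteq> P ! i"
    using ne eq len by (simp add: take_Suc_conv_app_nth)
  ultimately show thesis using that eq by blast
qed


section \<open>The search invariant\<close>

text \<open>The paths neither output nor discarded so far, where \<open>p\<close> is the current path up to the cursor.\<close>

definition unexplored ::
    "'a pair_pre_digraph \<Rightarrow> 'a \<Rightarrow> 'a \<Rightarrow> ('a \<times> 'a) awalk \<Rightarrow> ('a \<Rightarrow> ('a \<times> 'a) set)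
       \<Rightarrow> ('a \<times> 'a) awalk set" where
  "unexplored G s t p C =
     {Q \<in> simple_paths G s t. \<exists>i \<le> length p. i < length Q \<and> take i Q = take i p \<and>
        Q ! i \<notin> C (fst (Q ! i)) \<and> (i < length p \<longrightarrow> Q ! i \<noteq> p ! i)}"

text \<open>The prefix always arises as \<open>take k P\<close>. The witness \<open>i\<close> is
  where \<open>Q\<close> leaves it: before the cursor by an allowed arc other than that of
  \<open>P\<close>, at the cursor by any allowed arc.\<close>

lemma unexplored_iff:
  assumes "k < length P"
  shows "Q \<in> unexplored G s t (take k P) C \<longleftrightarrow>
    Q \<in> simple_paths G s t \<and> (\<exists>i \<le> k. i < length Q \<and> take i Q = take i P \<and>
      Q ! i \<notin> C (fst (Q ! i)) \<and> (i < k \<longrightarrow> Q ! i \<noteq> P ! i))"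
proof -
  have "length (take k P) = k" and "\<And>i. i \<le> k \<Longrightarrow> take i (take k P) = take i P"
    using assms by (simp_all add: min_def)
  then show ?thesis by (auto simp: unexplored_def)
qed

text \<open>\<open>k\<close> is the position of the cursor on \<open>P\<close>. Before it only the
  arcs of \<open>P\<close> survive, whatever \<open>C\<close> holds there: those entries are kept
  for later backtracking. Away from the vertices up to the cursor nothing is forbidden.\<close>

definition consistent ::
    "'a pair_pre_digraph \<Rightarrow> 'a \<Rightarrow> 'a \<Rightarrow> 'a pair_pre_digraph \<Rightarrow> ('a \<Rightarrow> ('a \<times> 'a) set)
       \<Rightarrow> nat \<Rightarrow> ('a \<times> 'a) awalk \<Rightarrow> bool" where
  "consistent G s t H C k P \<longleftrightarrow>
     P \<in> simple_paths G s t \<and> k < length P \<and> pverts H = pverts G \<and>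
     parcs H = {a \<in> parcs G. if fst a \<in> fst ` set (take k P) then a \<in> set (take k P)
                             else a \<notin> C (fst a)} \<and>
     (\<forall>x. x \<notin> fst ` set (take (Suc k) P) \<longrightarrow> C x = {}) \<and>
     (\<forall>x. \<forall>a \<in> C x. fst a = x)"

lemma consistentD:
  assumes "consistent G s t H C k P"
  shows "P \<in> simple_paths G s t" and "k < length P" and "pverts H = pverts G"
    and "a \<in> parcs H \<longleftrightarrow> a \<in> parcs G \<and>
      (if fst a \<in> fst ` set (take k P) then a \<in> set (take k P) else a \<notin> C (fst a))"
    and "x \<notin> fst ` set (take (Suc k) P) \<Longrightarrow> C x = {}"
    and "a \<in> C x \<Longrightarrow> fst a = x"
proof -
  have arcs: "parcs H = {a \<in> parcs G. if fst a \<in> fst ` set (take k P) then a \<in> set (take k P)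
                                    else a \<notin> C (fst a)}"
    and C: "\<forall>x. x \<notin> fst ` set (take (Suc k) P) \<longrightarrow> C x = {}" "\<forall>x. \<forall>a \<in> C x. fst a = x"
    and P: "P \<in> simple_paths G s t" "k < length P" "pverts H = pverts G"
    using assms unfolding consistent_def by - (elim conjE, assumption)+
  show "P \<in> simple_paths G s t" "k < length P" "pverts H = pverts G" by fact+
  show "a \<in> parcs H \<longleftrightarrow> a \<in> parcs G \<and>
      (if fst a \<in> fst ` set (take k P) then a \<in> set (take k P) else a \<notin> C (fst a))"
    unfolding arcs by (rule mem_Collect_eq)
  show "x \<notin> fst ` set (take (Suc k) P) \<Longrightarrow> C x = {}" using C(1) by blast
  show "a \<in> C x \<Longrightarrow> fst a = x" using C(2) by blast
qed

text \<open>Before the cursor each vertex has a single residual arc, which forces the prefix.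
  Conversely, a simple path with this prefix never returns to its vertices, and beyond the cursor
  \<open>C\<close> is empty, so no later arc is missing.\<close>

lemma simple_paths_residual:
  assumes con: "consistent G s t H C k P" and st: "s \<noteq> t"
  shows "Q \<in> simple_paths H s t \<longleftrightarrow>
    Q \<in> simple_paths G s t \<and> k < length Q \<and> take k Q = take k P \<and> Q ! k \<notin> C (fst (Q ! k))"
proof -
  note P = consistentD(1)[OF con] and k = consistentD(2)[OF con] and V = consistentD(3)[OF con]
    and A = consistentD(4)[OF con] and C = consistentD(5)[OF con]
  note p = P st
  have iff: "Q \<in> simple_paths H s t \<longleftrightarrow> Q \<in> simple_paths G s t \<and> set Q \<subseteq> parcs H"
    using V by (rule simple_paths_subgraph) (simp add: subset_iff A)
  show ?thesis
  proof
    assume "Q \<in> simple_paths H s t"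
    then have Q: "Q \<in> simple_paths G s t" and QH: "set Q \<subseteq> parcs H" using iff by auto
    have agree: "take i Q = take i P" if "i \<le> k" for i
      using that
    proof (induction i)
      case (Suc i)
      then have eq: "take i Q = take i P" and i: "i < length P" "i < k" using k by auto
      note l = simple_paths_agree[OF P Q st eq i(1)]
      \<comment> \<open>The common vertex lies on the prefix, where the residual graph offers only
        the prefix arc.\<close>
      have "fst (Q ! i) \<in> fst ` set (take k P)"
        using l i k simple_path_fst_in_take_iff[OF p] by simp
      moreover have "Q ! i \<in> parcs H" using QH nth_mem[OF l(1)] by blast
      ultimately have "Q ! i \<in> set (take k P)" by (simp add: A)
      then obtain j where j: "j < k" "Q ! i = P ! j" by (auto simp: in_set_conv_nth)
      then have "j = i" using l(2) i k simple_path_fst_eq_iff[OF p, of j i] by simp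
      then show ?case using eq l i j by (simp add: take_Suc_conv_app_nth)
    qed simp
    note l = simple_paths_agree[OF P Q st agree[OF order.refl] k]
    have "fst (Q ! k) \<notin> fst ` set (take k P)"
      using l k simple_path_fst_in_take_iff[OF p] by simp
    moreover have "Q ! k \<in> parcs H" using QH l(1) nth_mem by blast
    ultimately have "Q ! k \<notin> C (fst (Q ! k))" using A by simp
    then show "Q \<in> simple_paths G s t \<and> k < length Q \<and> take k Q = take k P \<and>
        Q ! k \<notin> C (fst (Q ! k))"
      using Q l agree by blast
  next
    assume R: "Q \<in> simple_paths G s t \<and> k < length Q \<and> take k Q = take k P \<and>
        Q ! k \<notin> C (fst (Q ! k))"
    then have Q: "Q \<in> simple_paths G s t" and kQ: "k < length Q" and eq: "take k Q = take k P"
      and nC: "Q ! k \<notin> C (fst (Q ! k))" by auto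
    note q = Q st
    \<comment> \<open>The arcs at \<open>k\<close> may differ, but they leave the same
      vertex.\<close>
    have eq': "fst ` set (take (Suc k) Q) = fst ` set (take (Suc k) P)"
      using eq k kQ simple_paths_agree(2)[OF P Q st eq k] by (simp add: take_Suc_conv_app_nth)
    have "Q ! i \<in> parcs H" if i: "i < length Q" for i
    proof -
      have G: "Q ! i \<in> parcs G" using simple_path_arcs[OF q] nth_mem[OF i] by blast
      show ?thesis
      proof (cases "i < k")
        case True
        have "Q ! i \<in> set (take k Q)" using True i kQ by (auto simp: in_set_conv_nth)
        then have "Q ! i \<in> set (take k P)" using eq by simp
        then show ?thesis using G by (auto simp: A)
      next
        case False
        have a: "fst (Q ! i) \<notin> fst ` set (take k P)"
          using False i kQ simple_path_fst_in_take_iff[OF q, of i k] eq by simp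
        have b: "Q ! i \<notin> C (fst (Q ! i))"
        proof (cases "i = k")
          case True then show ?thesis using nC by simp
        next
          case neq: False
          have "fst (Q ! i) \<notin> fst ` set (take (Suc k) P)"
            unfolding eq'[symmetric]
            using False neq i kQ simple_path_fst_in_take_iff[OF q, of i "Suc k"] by simp
          then show ?thesis using C by simp
        qed
        show ?thesis using G a b by (simp add: A)
      qed
    qed
    then have "set Q \<subseteq> parcs H" by (metis in_set_conv_nth subsetI)
    then show "Q \<in> simple_paths H s t" using iff Q by blast
  qed
qed

section \<open>The invariant under initialization, advancing and backtracking\<close>

lemma consistent_initial:
  assumes "P \<in> simple_paths G s t" and "s \<noteq> t"
  shows "consistent G s t G (\<lambda>_. {}) 0 P" and "unexplored G s t [] (\<lambda>_. {}) = simple_paths G s t"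
  using assms simple_path_nonempty[of _ G s t] by (auto simp: consistent_def unexplored_def)

text \<open>Forbidding the last arc of \<open>P'\<close> at its tail excludes only
  \<open>P'\<close>, since that arc completes the path. The vertices passed between the old and the
  new cursor have empty \<open>C\<close>, so all other branches off \<open>P'\<close> there stay
  open.\<close>

lemma consistent_advance:
  assumes con: "consistent G s t H C k P" and st: "s \<noteq> t" and P': "P' \<in> simple_paths H s t"
    and w: "w = fst (last P')"
  defines "C' \<equiv> C(w := C w \<union> {last P'})" and "m \<equiv> length P' - 1"
  shows "consistent G s t (remove_arcs H (fixing_arcs G P')) C' m P'"
    and "w = fst (P' ! m)"
    and "unexplored G s t (take m P') C' = unexplored G s t (take k P) C - {P'}"
    and "P' \<in> unexplored G s t (take k P) C"
proof -
  note P = consistentD(1)[OF con] and k = consistentD(2)[OF con] and V = consistentD(3)[OF con]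
    and A = consistentD(4)[OF con] and C = consistentD(5)[OF con] and Cfst = consistentD(6)[OF con]
  note res = simple_paths_residual[OF con st]
  have P'G: "P' \<in> simple_paths G s t" and kP': "k < length P'" and eq: "take k P' = take k P"
    and nC: "P' ! k \<notin> C (fst (P' ! k))" using P' res by auto
  note p = P st and p' = P'G st
  have m: "m < length P'" "Suc m = length P'" "k \<le> m" using kP' by (auto simp: m_def)
  have last: "last P' = P' ! m" using simple_path_nonempty[OF p'] by (simp add: m_def last_conv_nth)
  then show wm: "w = fst (P' ! m)" using w by simp
  have but: "butlast P' = take m P'" by (simp add: m_def butlast_conv_take)
  have eqS: "fst ` set (take (Suc k) P') = fst ` set (take (Suc k) P)"
    using eq k kP' simple_paths_agree(2)[OF P P'G st eq k] by (simp add: take_Suc_conv_app_nth)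
  have Cempty: "C (fst (P' ! i)) = {}" if "k < i" "i < length P'" for i
    using C that kP' simple_path_fst_in_take_iff[OF p', of i "Suc k"] eqS by simp
  have w_pre: "w \<notin> fst ` set (take m P')"
    using wm m simple_path_fst_in_take_iff[OF p', of m m] by simp
  have arcs': "parcs (remove_arcs H (fixing_arcs G P')) =
      {a \<in> parcs G. if fst a \<in> fst ` set (take m P') then a \<in> set (take m P') else a \<notin> C' (fst a)}"
    (is "?L = ?R")
  proof (rule set_eqI)
    fix a
    have sub: "set (take k P') \<subseteq> set (take m P')" using m by (simp add: set_take_subset_set_take)
    have F: "a \<in> fixing_arcs G P' \<longleftrightarrow>
        (a \<in> parcs G \<and> (\<exists>b \<in> set (take m P'). fst a = fst b \<and> a \<noteq> b)) \<or> a = P' ! m"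
      by (auto simp: fixing_arcs_def but last out_arcs_def)
    have inj: "a = b" if "a \<in> set (take m P')" "b \<in> set (take m P')" "fst a = fst b" for a b
      using that simple_path_distinct[OF p'] by (meson distinct_map inj_onD in_set_takeD)
    have "parcs H \<subseteq> parcs G" by (simp add: subset_iff A)
    then have pH: "set P' \<subseteq> parcs H" using P' simple_paths_subgraph[OF V] by blast
    \<comment> \<open>At tails of the new prefix only the path's own arc is left; elsewhere the sole
      loss is \<open>last P'\<close>.\<close>
    show "a \<in> ?L \<longleftrightarrow> a \<in> ?R"
    proof (cases "fst a \<in> fst ` set (take m P')")
      case True
      then obtain b where b: "b \<in> set (take m P')" "fst a = fst b" by auto
      have nm: "a \<noteq> P' ! m" using True w_pre wm by auto
      have bH: "b \<in> parcs H" using pH in_set_takeD[OF b(1)] by blast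
      have "(\<exists>b' \<in> set (take m P'). fst a = fst b' \<and> a \<noteq> b') \<longleftrightarrow> a \<noteq> b" using b inj by metis
      then have "a \<in> ?L \<longleftrightarrow> a \<in> parcs H \<and> (a \<in> parcs G \<longrightarrow> a = b)"
        using F nm by (simp add: remove_arcs_def)
      also have "\<dots> \<longleftrightarrow> a = b" using bH \<open>parcs H \<subseteq> parcs G\<close> by blast
      also have "\<dots> \<longleftrightarrow> a \<in> parcs G \<and> a \<in> set (take m P')"
        using b inj bH \<open>parcs H \<subseteq> parcs G\<close> by blast
      also have "\<dots> \<longleftrightarrow> a \<in> ?R" using True by simp
      finally show ?thesis .
    next
      case False
      then have nf: "fst a \<notin> fst ` set (take k P)" using sub eq by auto
      have "a \<in> ?L \<longleftrightarrow> a \<in> parcs G \<and> a \<notin> C (fst a) \<and> a \<noteq> P' ! m"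
        using False nf F by (auto simp: remove_arcs_def A)
      also have "\<dots> \<longleftrightarrow> a \<in> ?R" using False wm last by (auto simp: C'_def)
      finally show ?thesis .
    qed
  qed
  have C'empty: "C' x = {}" if "x \<notin> fst ` set (take (Suc m) P')" for x
  proof -
    have "x \<notin> fst ` set (take (Suc k) P)"
      using that m eqS set_take_subset_set_take[of "Suc k" "Suc m" P'] by auto
    moreover have "x \<noteq> w" using that m wm by auto
    ultimately show ?thesis using C by (simp add: C'_def)
  qed
  show "consistent G s t (remove_arcs H (fixing_arcs G P')) C' m P'"
    unfolding consistent_def
  proof (intro conjI)
    show "pverts (remove_arcs H (fixing_arcs G P')) = pverts G" using V by (simp add: remove_arcs_def)
    show "\<forall>x. \<forall>a\<in>C' x. fst a = x" by (auto simp: C'_def w dest: Cfst)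
  qed (use P'G m arcs' C'empty in auto)
  show P'un: "P' \<in> unexplored G s t (take k P) C"
    unfolding unexplored_iff[OF k] using P'G kP' eq nC by blast
  show "unexplored G s t (take m P') C' = unexplored G s t (take k P) C - {P'}"
  proof (intro set_eqI iffI)
    fix Q assume "Q \<in> unexplored G s t (take m P') C'"
    then obtain i where Q: "Q \<in> simple_paths G s t" and i: "i \<le> m" "i < length Q"
      "take i Q = take i P'" "Q ! i \<notin> C' (fst (Q ! i))" "i < m \<Longrightarrow> Q ! i \<noteq> P' ! i"
      unfolding unexplored_iff[OF m(1)] by blast
    \<comment> \<open>At \<open>i = m\<close> the arc avoids \<open>C'\<close>, which contains
      \<open>last P'\<close>; at smaller \<open>i\<close> the two paths differ by the choice of
      \<open>i\<close>.\<close>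
    have "Q \<noteq> P'" using i wm last by (cases "i = m") (auto simp: C'_def)
    moreover have "Q \<in> unexplored G s t (take k P) C"
    proof (cases "i \<le> k")
      case True
      have t1: "take i Q = take i P" using i(3) take_eq_mono[OF eq True] by simp
      have t2: "i < k \<Longrightarrow> P' ! i = P ! i" using take_eq_nth[OF eq] by simp
      have "Q ! i \<notin> C (fst (Q ! i))" using i(4) by (auto simp: C'_def split: if_splits)
      moreover have "i < k \<Longrightarrow> Q ! i \<noteq> P ! i" using i(5) t2 m(3) by simp
      ultimately show ?thesis unfolding unexplored_iff[OF k] using Q True i(2) t1 by blast
    next
      case False
      \<comment> \<open>\<open>Q\<close> leaves the old cursor along \<open>P' ! k\<close>, which
        was allowed there, so \<open>k\<close> is the witness.\<close>
      then have "take k Q = take k P" "Q ! k = P' ! k"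
        using take_eq_mono[OF i(3), of k] take_eq_nth[OF i(3), of k] eq by auto
      moreover have "k < length Q" using False i(2) by simp
      ultimately show ?thesis unfolding unexplored_iff[OF k] using Q nC by auto
    qed
    ultimately show "Q \<in> unexplored G s t (take k P) C - {P'}" by blast
  next
    fix Q assume "Q \<in> unexplored G s t (take k P) C - {P'}"
    then obtain i where Q: "Q \<in> simple_paths G s t" and ne: "Q \<noteq> P'" and i: "i \<le> k" "i < length Q"
      "take i Q = take i P" "Q ! i \<notin> C (fst (Q ! i))" "i < k \<Longrightarrow> Q ! i \<noteq> P ! i"
      unfolding Diff_iff unexplored_iff[OF k] by blast
    \<comment> \<open>The new witness is the first position where \<open>Q\<close> differs from
      \<open>P'\<close>.\<close>
    obtain j where j: "j < length P'" "j < length Q" "take j Q = take j P'" "Q ! j \<noteq> P' ! j"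
      "fst (Q ! j) = fst (P' ! j)"
      using first_divergence[OF P'G Q st ne] by blast
    have ij: "i \<le> j"
    proof (rule ccontr)
      assume "\<not> i \<le> j"
      then have "Q ! j = P ! j" "P' ! j = P ! j"
        using i(1) take_eq_nth[OF i(3), of j] take_eq_nth[OF eq, of j] by auto
      then show False using j by simp
    qed
    have "Q ! j \<notin> C (fst (Q ! j))"
    proof (cases "j \<le> k")
      case True
      \<comment> \<open>Below \<open>j\<close> the path \<open>Q\<close> agrees with
        \<open>P'\<close>, which agrees with \<open>P\<close> before the old cursor;
        \<open>i < j\<close> would contradict the departure from \<open>P\<close> at
        \<open>i\<close>.\<close>
      have "j = i"
      proof (rule ccontr)
        assume "j \<noteq> i"
        then have "i < j" using ij by simp
        then have "Q ! i = P' ! i" "P' ! i = P ! i"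
          using True take_eq_nth[OF j(3), of i] take_eq_nth[OF eq, of i] by auto
        then show False using i(5) \<open>i < j\<close> True by simp
      qed
      then show ?thesis using i by simp
    next
      case False
      then show ?thesis using Cempty[of j] j by simp
    qed
    have "j \<le> m" using j(1) m(2) by simp
    \<comment> \<open>Tails are unique on \<open>P'\<close>, so equality would force
      \<open>j = m\<close>, where the arcs already differ.\<close>
    have "Q ! j \<noteq> P' ! m" using j(1,4,5) m(1) simple_path_fst_eq_iff[OF p', of j m] by metis
    with \<open>Q ! j \<notin> C (fst (Q ! j))\<close> have "Q ! j \<notin> C' (fst (Q ! j))"
      using last by (auto simp: C'_def split: if_splits)
    then show "Q \<in> unexplored G s t (take m P') C'"
      unfolding unexplored_iff[OF m(1)] using Q j(2-4) \<open>j \<le> m\<close> by blast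
  qed
qed

text \<open>With an empty prefix a path can branch off only at the source, so a failed search there
  settles all that is left.\<close>

lemma unexplored_source:
  assumes con: "consistent G s t H C 0 P" and st: "s \<noteq> t"
  shows "unexplored G s t (take 0 P) C = simple_paths H s t"
  using simple_paths_residual[OF con st] by (auto simp: unexplored_def)

text \<open>Forbidding \<open>(u, v)\<close> at \<open>u\<close> cuts off the paths that follow
  \<open>P\<close> through this arc; those of them still unexplored are exactly the residual ones.
  \<open>C v\<close> is emptied because other routes may reach \<open>v\<close> again, free to leave
  by any arc.\<close>

lemma consistent_backtrack:
  assumes con: "consistent G s t H C (Suc k) P" and st: "s \<noteq> t"
    and v: "v = fst (P ! Suc k)" and u: "u = fst (P ! k)"
  defines "C1 \<equiv> C(v := {})"
  defines "C2 \<equiv> C1(u := C1 u \<union> {(u, v)})"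
  defines "H' \<equiv> remove_arcs
    (insert_arcs (insert_arcs H (out_arcs (with_proj G) v)) (out_arcs (with_proj G) u)) (C2 u)"
  shows "consistent G s t H' C2 k P"
    and "unexplored G s t (take k P) C2 = unexplored G s t (take (Suc k) P) C - simple_paths H s t"
proof -
  note P = consistentD(1)[OF con] and k = consistentD(2)[OF con] and V = consistentD(3)[OF con]
    and A = consistentD(4)[OF con] and C = consistentD(5)[OF con] and Cfst = consistentD(6)[OF con]
  note p = P st
  note res = simple_paths_residual[OF con st]
  have k': "k < length P" using k by simp
  have Pk: "P ! k = (u, v)" using simple_path_consecutive[OF p k] u v by (simp add: prod_eq_iff)
  have X1: "set (take (Suc k) P) = insert (u, v) (set (take k P))"
    using k Pk by (simp add: take_Suc_conv_app_nth)
  have X2: "set (take (Suc (Suc k)) P) = insert (P ! Suc k) (insert (u, v) (set (take k P)))"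
    using k by (simp add: take_Suc_conv_app_nth[of "Suc k"] X1)
  have uX: "u \<notin> fst ` set (take k P)" and vX: "v \<notin> fst ` set (take k P)" and uv: "u \<noteq> v"
    using simple_path_fst_in_take_iff[OF p, of k k] simple_path_fst_in_take_iff[OF p, of "Suc k" k]
      simple_path_fst_eq_iff[OF p, of k "Suc k"] k u v by auto
  have C2: "C2 x = (if x = u then C u \<union> {(u, v)} else if x = v then {} else C x)" for x
    using uv by (auto simp: C2_def C1_def)
  have arcs': "parcs H' =
      {a \<in> parcs G. if fst a \<in> fst ` set (take k P) then a \<in> set (take k P) else a \<notin> C2 (fst a)}"
    (is "_ = ?R")
  proof (rule set_eqI)
    fix a
    have L: "a \<in> parcs H' \<longleftrightarrow>
        (a \<in> parcs H \<or> a \<in> parcs G \<and> (fst a = v \<or> fst a = u)) \<and> a \<notin> C2 u"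
      by (auto simp: H'_def remove_arcs_def insert_arcs_def out_arcs_def)
    have C2u: "a \<in> C2 u \<Longrightarrow> fst a = u" by (auto simp: C2 dest: Cfst split: if_splits)
    \<comment> \<open>All changes concern arcs leaving \<open>u\<close> or \<open>v\<close>, and
      \<open>C2 u\<close> holds only arcs with tail \<open>u\<close>.\<close>
    consider "fst a = u" | "fst a = v" | "fst a \<noteq> u" "fst a \<noteq> v" by blast
    then show "a \<in> parcs H' \<longleftrightarrow> a \<in> ?R"
    proof cases
      case 1
      then show ?thesis using L uX A[of a] by auto
    next
      case 2
      then have "a \<notin> C2 u" using uv C2u by metis
      then show ?thesis using 2 L vX uv A[of a] by (auto simp: C2)
    next
      case 3
      then have "a \<notin> C2 u" using C2u by blast
      then show ?thesis using L 3 unfolding A X1 by (auto simp: C2)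
    qed
  qed
  show "consistent G s t H' C2 k P"
    unfolding consistent_def
  proof (intro conjI allI impI)
    show "pverts H' = pverts G" using V by (simp add: H'_def remove_arcs_def insert_arcs_def)
    show "C2 x = {}" if "x \<notin> fst ` set (take (Suc k) P)" for x
      using that C[of x] v unfolding X1 X2 by (auto simp: C2)
    show "\<forall>a\<in>C2 x. fst a = x" for x by (auto simp: C2 dest: Cfst split: if_splits)
  qed (use P k arcs' in auto)
  show "unexplored G s t (take k P) C2 = unexplored G s t (take (Suc k) P) C - simple_paths H s t"
    (is "?U2 = ?U1 - _")
  proof (intro set_eqI iffI)
    fix Q assume "Q \<in> ?U2"
    then obtain i where Q: "Q \<in> simple_paths G s t" and i: "i \<le> k" "i < length Q"
      "take i Q = take i P" "Q ! i \<notin> C2 (fst (Q ! i))" "i < k \<Longrightarrow> Q ! i \<noteq> P ! i"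
      unfolding unexplored_iff[OF k'] by blast
    have fi: "fst (Q ! i) = fst (P ! i)" using simple_paths_agree(2)[OF P Q st i(3)] i k by simp
    \<comment> \<open>At \<open>i = k\<close> the arc of \<open>P\<close> is \<open>(u, v)\<close>,
      which \<open>C2 u\<close> excludes.\<close>
    have neq: "Q ! i \<noteq> P ! i"
      using i Pk fi by (cases "i = k") (auto simp: C2)
    \<comment> \<open>\<open>v\<close> sits at position \<open>Suc k\<close>, after
      \<open>i\<close>, so emptying \<open>C v\<close> has not opened this branch.\<close>
    have "fst (Q ! i) \<noteq> v"
      using fi v i k simple_path_fst_eq_iff[OF p, of i "Suc k"] by simp
    then have "Q ! i \<notin> C (fst (Q ! i))" using i(4) by (auto simp: C2 split: if_splits)
    then have "Q \<in> ?U1"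
      unfolding unexplored_iff[OF k] using Q i(2,3) neq le_SucI[OF i(1)] by blast
    \<comment> \<open>Paths of \<open>H\<close> follow \<open>P\<close> through position
      \<open>k\<close>, but \<open>Q\<close> has left it at \<open>i\<close>.\<close>
    moreover have "Q \<notin> simple_paths H s t"

      using take_eq_nth[of "Suc k" Q P i] i(1) neq by (auto simp: res)
    ultimately show "Q \<in> ?U1 - simple_paths H s t" by blast
  next
    fix Q assume asm: "Q \<in> ?U1 - simple_paths H s t"
    then have "Q \<in> ?U1" by (rule DiffD1)
    then obtain i where Q: "Q \<in> simple_paths G s t" and i: "i \<le> Suc k" "i < length Q"
      "take i Q = take i P" "Q ! i \<notin> C (fst (Q ! i))" "i < Suc k \<Longrightarrow> Q ! i \<noteq> P ! i"
      unfolding unexplored_iff[OF k] by blast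
    have "i \<noteq> Suc k"
    proof
      assume "i = Suc k"
      then have "Q \<in> simple_paths H s t" unfolding res using Q i(2-4) by simp
      then show False using asm by simp
    qed
    then have ik: "i \<le> k" using i by simp
    have fi: "fst (Q ! i) = fst (P ! i)" using simple_paths_agree(2)[OF P Q st i(3)] ik k by simp
    \<comment> \<open>Equal tails would give \<open>i = k\<close>, where \<open>Q\<close> differs
      from \<open>P\<close>.\<close>
    have "Q ! i \<noteq> (u, v)"
    proof
      assume "Q ! i = (u, v)"
      then have "fst (P ! i) = fst (P ! k)" using fi Pk by simp
      then have "i = k" using simple_path_fst_eq_iff[OF p] ik k' by (metis le_less_trans)
      then show False using \<open>Q ! i = (u, v)\<close> Pk i(5) by simp
    qed
    then have "Q ! i \<notin> C2 (fst (Q ! i))" using i(4) by (auto simp: C2)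
    then show "Q \<in> ?U2"
      unfolding unexplored_iff[OF k'] using Q i(2,3) ik i(5)[OF le_imp_less_Suc[OF ik]]
      by (intro conjI exI[of _ i]) simp_all
  qed
qed

section \<open>Runs of the algorithm\<close>

lemma uspp_optimal_exists:
  assumes "finite (simple_paths H s t)" "simple_paths H s t \<noteq> {}"
  shows "\<exists>P. uspp_optimal H c lam s t P"
  using ex_is_arg_min_if_finite[OF assms] by (auto simp: uspp_optimal_def)

text \<open>A single optimum above \<open>B\<close> is a lower bound for all residual paths, so a
  failed search may discard them together.\<close>

lemma search_fails_cost:
  assumes "search_fails H c lam s t B" "Q \<in> simple_paths H s t"
  shows "real_of_int (univ_cost H c lam Q) > B"
proof -
  obtain P where P: "uspp_optimal H c lam s t P" "real_of_int (univ_cost H c lam P) > B"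
    using assms by (auto simp: search_fails_def)
  then have "univ_cost H c lam P \<le> univ_cost H c lam Q"
    using assms(2) by (auto simp: uspp_optimal_def is_arg_min_linorder)
  then have "real_of_int (univ_cost H c lam P) \<le> real_of_int (univ_cost H c lam Q)" by simp
  then show ?thesis using P(2) by linarith
qed

text \<open>The pair \<open>m\<close> is a termination measure for the lexicographic order.\<close>

definition run_inv ::
    "'a pair_pre_digraph \<Rightarrow> ('a \<times> 'a \<Rightarrow> nat) \<Rightarrow> (nat \<Rightarrow> int) \<Rightarrow> 'a \<Rightarrow> 'a \<Rightarrow> real
       \<Rightarrow> 'a unssp_state \<Rightarrow> nat \<times> nat \<Rightarrow> bool" where
  "run_inv G c lam s t B \<sigma> m \<longleftrightarrow>
     (case cursor \<sigma> of
        None \<Rightarrow> m = (0, 0) \<and> set (printed \<sigma>) = near_shortest_paths G c lam s t B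
      | Some v \<Rightarrow> \<exists>k. consistent G s t (residual \<sigma>) (forbidden \<sigma>) k (current \<sigma>) \<and>
          v = fst (current \<sigma> ! k) \<and>
          m = (card (unexplored G s t (take k (current \<sigma>)) (forbidden \<sigma>)), Suc k) \<and>
          set (printed \<sigma>) \<subseteq> near_shortest_paths G c lam s t B \<and>
          near_shortest_paths G c lam s t B \<subseteq>
            set (printed \<sigma>) \<union> unexplored G s t (take k (current \<sigma>)) (forbidden \<sigma>))"

lemma run_inv_Some:
  "run_inv G c lam s t B
     \<lparr>residual = H, forbidden = C, cursor = Some v, current = P, printed = out\<rparr> m \<longleftrightarrow>
   (\<exists>k. consistent G s t H C k P \<and> v = fst (P ! k) \<and>
      m = (card (unexplored G s t (take k P) C), Suc k) \<and>
      set out \<subseteq> near_shortest_paths G c lam s t B \<and>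
      near_shortest_paths G c lam s t B \<subseteq> set out \<union> unexplored G s t (take k P) C)"
  by (simp add: run_inv_def)

lemma run_inv_init:
  assumes "unssp_init G c lam s t B \<sigma>" and st: "s \<noteq> t"
  shows "\<exists>m. run_inv G c lam s t B \<sigma> m"
  using assms(1)
proof cases
  case (1 P)
  have P: "P \<in> simple_paths G s t" using 1 by (simp add: uspp_optimal_def is_arg_min_def)
  \<comment> \<open>Initialization is an advance from a fictitious state with residual graph
    \<open>G\<close>, empty \<open>C\<close> and the cursor at position 0.\<close>
  note adv = consistent_advance[OF consistent_initial(1)[OF P st] st P refl]
  let ?C = "(\<lambda>_. {})(fst (last P) := {last P})" and ?k = "length P - 1"
    and ?out = "if real_of_int (univ_cost G c lam P) \<le> B then [P] else []"
  have U: "unexplored G s t (take ?k P) ?C = simple_paths G s t - {P}"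
    using adv(3) consistent_initial(2)[OF P st] by simp
  \<comment> \<open>With negative weights the optimum can be negative and \<open>B\<close> can lie
    below it; then \<open>P\<close> is not near shortest and skipping it loses nothing.\<close>
  have "set ?out \<subseteq> near_shortest_paths G c lam s t B"
    and "near_shortest_paths G c lam s t B \<subseteq> set ?out \<union> unexplored G s t (take ?k P) ?C"
    unfolding U using P by (auto simp: near_shortest_paths_def)
  moreover have "consistent G s t (remove_arcs G (fixing_arcs G P)) ?C ?k P"
    using adv(1) by simp
  ultimately have "run_inv G c lam s t B \<sigma> (card (unexplored G s t (take ?k P) ?C), Suc ?k)"
    unfolding 1 run_inv_Some using adv(2) by blast
  then show ?thesis ..
qed

lemma run_inv_step:
  assumes fin: "pair_fin_digraph G" and st: "s \<noteq> t"
    and inv: "run_inv G c lam s t B \<sigma> m" and step: "unssp_step G c lam s t B \<sigma> \<tau>"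
  shows "\<exists>m'. run_inv G c lam s t B \<tau> m' \<and> (m', m) \<in> less_than <*lex*> less_than"
proof -
  let ?near = "near_shortest_paths G c lam s t B"
  have finU: "finite (unexplored G s t p C)" for p C
    using finite_simple_paths[OF fin] by (rule rev_finite_subset) (auto simp: unexplored_def)
  have discarded: "?near \<inter> simple_paths H s t = {}"
    if "search_fails H c lam s t B" "pverts H = pverts G" for H
    using that search_fails_cost[of H c lam s t B] univ_cost_cong[of H G]
    by (fastforce simp: near_shortest_paths_def)
  show ?thesis
    using step
  proof cases
    case (backtrack H P v u C1 C C2 H' out)
    then obtain k where con: "consistent G s t H C k P" and v: "v = fst (P ! k)"
      and m: "m = (card (unexplored G s t (take k P) C), Suc k)"
      and out: "set out \<subseteq> ?near" "?near \<subseteq> set out \<union> unexplored G s t (take k P) C"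
      using inv unfolding backtrack(1) run_inv_Some by blast
    note P = consistentD(1-3)[OF con]
    have "k \<noteq> 0" "u = fst (P ! (k - 1))"
      using pred_on_nth[OF P(1) st P(2)] backtrack(4) v by (auto split: if_splits)
    then obtain j where k: "k = Suc j" and u: "u = fst (P ! j)" by (cases k) auto
    note bt = consistent_backtrack[OF con[unfolded k] st v[unfolded k] u,
        folded backtrack(5), folded backtrack(6), folded backtrack(7)]
    let ?m' = "(card (unexplored G s t (take j P) C2), Suc j)"
    \<comment> \<open>The residual graph may have no path at all, so only a weak inequality holds;
      the depth component then decreases.\<close>
    have "card (unexplored G s t (take j P) C2) \<le> card (unexplored G s t (take k P) C)"
      using bt(2) k finU by (intro card_mono) auto
    then have "(?m', m) \<in> less_than <*lex*> less_than" using m k by auto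
    moreover have "run_inv G c lam s t B \<tau> ?m'"
    proof -
      have "?near \<subseteq> set out \<union> unexplored G s t (take j P) C2"
        using out(2) discarded[OF backtrack(3) P(3)] unfolding bt(2) k by blast
      then show ?thesis unfolding backtrack(2) run_inv_Some using bt(1) u out(1) by blast
    qed
    ultimately show ?thesis by blast
  next
    case (backtrack_source H P v C out)
    then obtain k where con: "consistent G s t H C k P" and v: "v = fst (P ! k)"
      and m: "m = (card (unexplored G s t (take k P) C), Suc k)"
      and out: "set out \<subseteq> ?near" "?near \<subseteq> set out \<union> unexplored G s t (take k P) C"
      using inv unfolding backtrack_source(1) run_inv_Some by blast
    note P = consistentD(1-3)[OF con]
    have k: "k = 0"
      using pred_on_nth[OF P(1) st P(2)] backtrack_source(4) v by (auto split: if_splits)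
    have "unexplored G s t (take k P) C = simple_paths H s t"
      using unexplored_source con st k by metis
    then have "set out = ?near" using out discarded[OF backtrack_source(3) P(3)] by auto
    \<comment> \<open>The component \<open>Suc k\<close> is positive even at the source, which keeps
      \<open>(0, 0)\<close> free for the stopped state.\<close>
    then show ?thesis using m by (auto simp: run_inv_def backtrack_source(2))
  next
    case (advance H P' w C v P out)
    then obtain k where con: "consistent G s t H C k P"
      and m: "m = (card (unexplored G s t (take k P) C), Suc k)"
      and out: "set out \<subseteq> ?near" "?near \<subseteq> set out \<union> unexplored G s t (take k P) C"
      using inv unfolding advance(1) run_inv_Some by blast
    have P': "P' \<in> simple_paths H s t" using advance by (simp add: uspp_optimal_def is_arg_min_def)
    note adv = consistent_advance[OF con st P' advance(5)]
    let ?C = "C(w := C w \<union> {last P'})" and ?k = "length P' - 1"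
    let ?m' = "(card (unexplored G s t (take ?k P') ?C), Suc ?k)"
    \<comment> \<open>\<open>P'\<close> leaves the unexplored set, so the depth may grow.\<close>
    have "card (unexplored G s t (take ?k P') ?C) < card (unexplored G s t (take k P) C)"
      unfolding adv(3) using adv(4) finU by (intro psubset_card_mono) auto
    then have "(?m', m) \<in> less_than <*lex*> less_than" using m by auto
    moreover have "P' \<in> ?near"
    proof -
      note consistentD(3)[OF con]
      then show ?thesis
        using advance(4) univ_cost_cong[of H G] simple_paths_residual[OF con st] P'
        by (simp add: near_shortest_paths_def)
    qed
    have "run_inv G c lam s t B \<tau> ?m'"
    proof -
      have "set (out @ [P']) \<subseteq> ?near" using out(1) \<open>P' \<in> ?near\<close> by simp
      moreover have "?near \<subseteq> set (out @ [P']) \<union> unexplored G s t (take ?k P') ?C"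
        unfolding adv(3) using out(2) by auto
      ultimately show ?thesis unfolding advance(2) run_inv_Some using adv(1,2) by blast
    qed
    ultimately show ?thesis by blast
  qed
qed

text \<open>Residual path sets are finite, so a nonempty one has an optimum, whose cost decides
  between advancing and backtracking. A live cursor thus always admits a rule.\<close>

lemma run_inv_progress:
  assumes fin: "pair_fin_digraph G" and st: "s \<noteq> t"
    and inv: "run_inv G c lam s t B \<sigma> m" and stuck: "\<nexists>\<tau>. unssp_step G c lam s t B \<sigma> \<tau>"
  shows "cursor \<sigma> = None"
proof (rule ccontr)
  assume "cursor \<sigma> \<noteq> None"
  then obtain H C v P out where \<sigma>:
    "\<sigma> = \<lparr>residual = H, forbidden = C, cursor = Some v, current = P, printed = out\<rparr>"
    by (cases \<sigma>) auto
  obtain k where con: "consistent G s t H C k P"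
    using inv unfolding \<sigma> run_inv_Some by blast
  have "finite (simple_paths H s t)"
    by (rule finite_subset[OF _ finite_simple_paths[OF fin]])
      (auto simp: simple_paths_residual[OF con st])
  then have "search_fails H c lam s t B \<or>
      (\<exists>P'. uspp_optimal H c lam s t P' \<and> real_of_int (univ_cost H c lam P') \<le> B)"
    using uspp_optimal_exists[of H s t c lam] unfolding search_fails_def by (meson not_le)
  then show False
  proof
    assume fails: "search_fails H c lam s t B"
    show False
    proof (cases "pred_on P v")
      case None
      then show False using stuck unssp_step.backtrack_source[OF fails None] \<sigma> by blast
    next
      case (Some u)
      then show False using stuck unssp_step.backtrack[OF fails Some refl refl refl] \<sigma> by blast
    qed
  next
    assume "\<exists>P'. uspp_optimal H c lam s t P' \<and> real_of_int (univ_cost H c lam P') \<le> B"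
    then obtain P' where "uspp_optimal H c lam s t P'"
      and "real_of_int (univ_cost H c lam P') \<le> B" by blast
    from unssp_step.advance[OF this refl] show False using stuck \<sigma> by blast
  qed
qed

section \<open>Termination and correctness of complete runs\<close>

lemma run_inv_no_infinite_run:
  assumes "pair_fin_digraph G" "s \<noteq> t" "run_inv G c lam s t B (\<rho> 0) m"
    and "\<And>i. unssp_step G c lam s t B (\<rho> i) (\<rho> (Suc i))"
  shows False
proof -
  have "wf (less_than <*lex*> less_than)" by auto
  then show False
    using assms(3,4)
  proof (induction m arbitrary: \<rho> rule: wf_induct_rule)
    case (less m)
    obtain m' where "run_inv G c lam s t B (\<rho> (Suc 0)) m'" "(m', m) \<in> less_than <*lex*> less_than"
      using run_inv_step[OF assms(1,2) less.prems(1)] less.prems(2) by blast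
    \<comment> \<open>The induction hypothesis applies to the run without its first state.\<close>
    then show ?case using less.IH[of m' "\<lambda>i. \<rho> (Suc i)"] less.prems(2) by blast
  qed
qed

text \<open>Ties between optimal paths make runs nondeterministic, so every run has to terminate
  with the right set; the existence of an initial state keeps this from being vacuous.\<close>

theorem theorem3p14:
  fixes G :: "'a pair_pre_digraph"
    and c :: "'a \<times> 'a \<Rightarrow> nat"
    and lam :: "nat \<Rightarrow> int"
    and s t :: 'a
    and eps B :: real
  assumes "pair_fin_digraph G"
    and "s \<in> pverts G" and "t \<in> pverts G" and "s \<noteq> t"
    and "simple_paths G s t \<noteq> {}"
    and "eps \<ge> 0"
    and "B = (1 + eps) * real_of_int (uspp_value G c lam s t)"
  shows "(\<exists>\<sigma>0. unssp_init G c lam s t B \<sigma>0) \<and>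
    (\<forall>\<sigma>0. unssp_init G c lam s t B \<sigma>0 \<longrightarrow>
       (\<nexists>\<rho>. \<rho> 0 = \<sigma>0 \<and> (\<forall>i. unssp_step G c lam s t B (\<rho> i) (\<rho> (Suc i)))) \<and>
       (\<forall>\<sigma>. (unssp_step G c lam s t B)\<^sup>*\<^sup>* \<sigma>0 \<sigma> \<and> (\<nexists>\<tau>. unssp_step G c lam s t B \<sigma> \<tau>) \<longrightarrow>
          cursor \<sigma> = None \<and> set (printed \<sigma>) = near_shortest_paths G c lam s t B))"
proof (intro conjI allI impI; (elim conjE)?)
  obtain P where "uspp_optimal G c lam s t P"
    using uspp_optimal_exists[OF finite_simple_paths[OF assms(1)] assms(5)] by blast
  then show "\<exists>\<sigma>0. unssp_init G c lam s t B \<sigma>0"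
    by (intro exI) (rule unssp_init.intros)
next
  fix \<sigma>0 assume init: "unssp_init G c lam s t B \<sigma>0"
  then obtain m where m: "run_inv G c lam s t B \<sigma>0 m" using run_inv_init[OF _ assms(4)] by blast
  then show "\<nexists>\<rho>. \<rho> 0 = \<sigma>0 \<and> (\<forall>i. unssp_step G c lam s t B (\<rho> i) (\<rho> (Suc i)))"
    using run_inv_no_infinite_run[OF assms(1,4)] by blast
  fix \<sigma>
  assume run: "(unssp_step G c lam s t B)\<^sup>*\<^sup>* \<sigma>0 \<sigma>"
    and stuck: "\<nexists>\<tau>. unssp_step G c lam s t B \<sigma> \<tau>"
  from run have "\<exists>m. run_inv G c lam s t B \<sigma> m"
    by induction (use m run_inv_step[OF assms(1,4)] in blast)+
  then obtain m' where inv: "run_inv G c lam s t B \<sigma> m'" ..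
  show stopped: "cursor \<sigma> = None" using run_inv_progress[OF assms(1,4) inv stuck] .
  show "set (printed \<sigma>) = near_shortest_paths G c lam s t B"
    using inv stopped by (simp add: run_inv_def)
qed

end
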